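(* There exists a sequence $(B_p)_{p\ge 1}$ of rational numbers such that $\zeta(2p) = B_p\,\pi^{2p}$ for every integer $p\ge 1$. The terms of this sequence are determined by $B_1=\frac{1}{6}$ and by the recurrence relation $$\forall p\ge 2,\quad B_p = \frac{(-1)^{p-1}}{(2p)!}\left(\frac{p}{2p+1} - \sum_{k=1}^{p-1}(-1)^{k-1}\frac{(2p)!}{(2p+1-2k)!}B_k\right).$$ Moreover, $$\forall p\ge 1,\quad B_p = \frac{4^p}{4^p-2}\,A_p.$$
   Context: For real $x>1$, $\zeta(x)=\sum_{n=1}^{+\infty}\frac{1}{n^x}$. For real $x>0$, $\xi(x)=\sum_{n=1}^{+\infty}\frac{(-1)^{n-1}}{n^x}$. The numbers $A_p$ ($p\ge 1$) are defined by $A_p = \xi(2p)/\pi^{2p}$; they are rational and determined by $A_1=\frac{1}{12}$ and, for $p\ge 2$, $A_p = \frac{(-1)^{p-1}}{(2p)!}\left(\frac{1}{2(2p+1)} - \sum_{k=1}^{p-1}(-1)^{k-1}\frac{(2p)!}{(2p+1-2k)!}A_k\right)$. *)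

theory Defs
  imports "HOL-Analysis.Analysis" "HOL-Real_Asymp.Real_Asymp"
begin

text \<open>Meaningful for \<open>x > 1\<close>, where the series converges.\<close>
definition zeta :: "real \<Rightarrow> real" where
  "zeta x = (\<Sum>n. 1 / real (Suc n) powr x)"

text \<open>Meaningful for \<open>x > 0\<close>; the summation index is shifted by one, so the sign is \<open>(-1)^n\<close>.\<close>
definition xi :: "real \<Rightarrow> real" where
  "xi x = (\<Sum>n. (-1) ^ n / real (Suc n) powr x)"

definition A :: "nat \<Rightarrow> real" where
  "A p = xi (2 * real p) / pi ^ (2 * p)"

text \<open>The initial value and the recurrence relation; no condition is put on \<open>B 0\<close>.\<close>
definition zeta_recurrence :: "(nat \<Rightarrow> rat) \<Rightarrow> bool" where
  "zeta_recurrence B \<longleftrightarrow>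
     B 1 = 1 / 6 \<and>
     (\<forall>p\<ge>2. B p = (-1) ^ (p - 1) / fact (2 * p) *
        (of_nat p / of_nat (2 * p + 1)
         - (\<Sum>k = 1..p - 1. (-1) ^ (k - 1) * (fact (2 * p) / fact (2 * p + 1 - 2 * k)) * B k)))"

lemma summable_zeta: "summable (\<lambda>n. 1 / real (Suc n) powr x)" if "x > 1"
proof -
  have "summable (\<lambda>n. real n powr (- x))"
    using that by (simp add: summable_real_powr_iff)
  then have "summable (\<lambda>n. real (Suc n) powr (- x))"
    by (subst summable_Suc_iff)
  then show ?thesis
    by (simp add: powr_minus_divide)
qed

lemma summable_xi: "summable (\<lambda>n. (-1) ^ n / real (Suc n) powr x)" if "x > 0"
proof -
  have "(\<lambda>n. real (Suc n) powr (- x)) \<longlonglongrightarrow> 0"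
    using that by real_asymp
  moreover have "monoseq (\<lambda>n. real (Suc n) powr (- x))"
    using that by (intro decseq_imp_monoseq decseq_SucI powr_mono2') auto
  ultimately have "summable (\<lambda>n. (-1) ^ n * real (Suc n) powr (- x))"
    by (rule summable_Leibniz(1))
  then show ?thesis
    by (simp add: powr_minus_divide)
qed

end

theory Submission imports Defs
begin

text \<open>
  Taking logarithms in Euler's product for the sine gives
  \<open>ln (sin \<pi>x / \<pi>x) = - (\<Sum>k\<ge>1. \<zeta>(2k) x\<^sup>2\<^sup>k / k)\<close> for \<open>0 < x < 1\<close>, and differentiating yields
  \<open>\<pi>x cot \<pi>x = 1 - 2 (\<Sum>k\<ge>1. \<zeta>(2k) x\<^sup>2\<^sup>k)\<close>. Multiplying by the power series of \<open>sin \<pi>x / \<pi>x\<close>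
  and comparing coefficients with those of \<open>cos \<pi>x\<close> gives the recurrence; rationality follows from it
  by induction.
\<close>

section \<open>Double series and coefficients of power series\<close>

lemma zeta_even_sums:
  assumes "k \<ge> 1"
  shows "(\<lambda>n. 1 / real (Suc n) ^ (2 * k)) sums zeta (2 * real k)"
proof -
  have "1 / real (Suc n) powr (2 * real k) = 1 / real (Suc n) ^ (2 * k)" for n
    using powr_realpow[of "real (Suc n)" "2 * k"] by simp
  moreover have "(\<lambda>n. 1 / real (Suc n) powr (2 * real k)) sums zeta (2 * real k)"
    unfolding zeta_def using assms by (intro summable_sums summable_zeta) simp
  ultimately show ?thesis by simp
qed

lemma zeta_even_nonneg: "k \<ge> 1 \<Longrightarrow> zeta (2 * real k) \<ge> 0"
  by (rule sums_le[OF _ sums_zero zeta_even_sums]) auto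

text \<open>Tonelli's theorem for series: since the terms are nonnegative, convergence of the
  iterated sum gives unconditional summability over all pairs, so the order of summation can be
  exchanged.\<close>

lemma sums_swap_nonneg:
  fixes f :: "nat \<Rightarrow> nat \<Rightarrow> real"
  assumes nonneg: "\<And>n k. f n k \<ge> 0"
    and rows: "\<And>n. f n sums r n"
    and total: "r sums s"
    and cols: "\<And>k. (\<lambda>n. f n k) sums c k"
  shows "c sums s"
proof -
  have r: "((\<lambda>k. f n k) has_sum r n) UNIV" for n
    by (rule sums_nonneg_imp_has_sum[OF rows nonneg])
  have "r n \<ge> 0" for n
    using r[of n] nonneg by (rule has_sum_nonneg)
  then have s: "(r has_sum s) UNIV"
    by (rule sums_nonneg_imp_has_sum[OF total])
  have "(\<lambda>(n, k). f n k) summable_on (UNIV \<times> UNIV)"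
    by (rule summable_on_SigmaI[where g = r]) (use r s nonneg in \<open>auto simp: summable_on_def\<close>)
  then have "((\<lambda>(n, k). f n k) has_sum s) (UNIV \<times> UNIV)"
    by (intro has_sum_SigmaI[where g = r]) (use r s in auto)
  then have "((\<lambda>(k, n). f n k) has_sum s) (UNIV \<times> UNIV)"
    by (subst (asm) has_sum_swap) simp
  then have "(c has_sum s) UNIV"
    by (rule has_sum_SigmaD) (use sums_nonneg_imp_has_sum[OF cols nonneg] in simp)
  then show ?thesis by (rule has_sum_imp_sums)
qed

text \<open>A one-sided identity theorem, suited to the argument \<open>t = x^2\<close>, which takes
  only positive values. Once the coefficients below \<open>m\<close> vanish, dividing by
  \<open>t ^ m\<close> and letting \<open>t\<close> tend to 0 from the right isolates
  \<open>a m\<close>.\<close>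

lemma powser_sums_0_imp_coeff_0:
  fixes a :: "nat \<Rightarrow> real"
  assumes "r > 0" and zero: "\<And>t. 0 < t \<Longrightarrow> t < r \<Longrightarrow> (\<lambda>n. a n * t ^ n) sums 0"
  shows "a n = 0"
proof (induction n rule: less_induct)
  case (less m)
  define b where "b n = a (n + m)" for n
  have b: "(\<lambda>n. b n * t ^ n) sums 0" if "0 < t" "t < r" for t
  proof -
    have "(\<lambda>n. a (n + m) * t ^ (n + m)) sums (0 - (\<Sum>i<m. a i * t ^ i))"
      by (rule sums_split_initial_segment[OF zero[OF that]])
    then have "(\<lambda>n. (b n * t ^ n) * t ^ m) sums (0 * t ^ m)"
      using less by (simp add: b_def power_add mult.assoc)
    then show ?thesis
      using that by (subst (asm) sums_mult2_iff) auto
  qed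
  \<comment> \<open>Convergence at the sample point \<open>r / 2\<close> gives continuity at 0,
    where the series has the value \<open>b 0\<close>.\<close>
  have "isCont (\<lambda>t. \<Sum>n. b n * t ^ n) 0"
    by (rule isCont_powser[where K = "r / 2"]) (use b[of "r / 2"] \<open>r > 0\<close> in \<open>auto simp: sums_iff\<close>)
  then have "((\<lambda>t. \<Sum>n. b n * t ^ n) \<longlongrightarrow> b 0) (at_right 0)"
    by (auto simp: isCont_def intro: filterlim_mono at_le)
  moreover have "\<forall>\<^sub>F t in at_right 0. (\<Sum>n. b n * t ^ n) = 0"
    using eventually_at_right_less[of 0] eventually_at_right_real[OF \<open>r > 0\<close>]
    by eventually_elim (use b in \<open>auto simp: sums_iff\<close>)
  ultimately have "((\<lambda>t. 0) \<longlongrightarrow> b 0) (at_right (0::real))"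
    by (rule Lim_transform_eventually)
  then have "b 0 = 0"
    by (simp add: tendsto_const_iff)
  then show "a m = 0" by (simp add: b_def)
qed

section \<open>Power series from the sine product\<close>

lemma sin_pi_pos: "sin (pi * x) > 0" if "0 < x" "x < 1"
proof (rule sin_gt_zero)
  show "0 < pi * x" using that by simp
  show "pi * x < pi" using that mult_strict_left_mono[of x 1 pi] by simp
qed

text \<open>The term for \<open>k = 0\<close> vanishes because of the division by zero.\<close>
lemma ln_sin_sums:
  fixes x :: real
  assumes x: "0 < x" "x < 1"
  shows "(\<lambda>k. zeta (2 * real k) / real k * (x\<^sup>2) ^ k) sums - ln (sin (pi * x) / (pi * x))"
proof (rule sums_swap_nonneg)
  \<comment> \<open>\<open>1 - q n\<close> is the factor of Euler's product belonging to the integer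
    \<open>n + 1\<close>. Row \<open>n\<close> expands \<open>- ln (1 - q n)\<close> in powers of
    \<open>q n\<close>; column \<open>k\<close> collects a zeta value.\<close>
  define q where "q n = x\<^sup>2 / (real (Suc n))\<^sup>2" for n
  have q: "0 \<le> q n" "q n < 1" for n
  proof -
    have "x < real (Suc n)" using x by simp
    then have "x\<^sup>2 < (real (Suc n))\<^sup>2" using x by (intro power_strict_mono) auto
    then show "q n < 1" by (simp add: q_def)
  qed (simp add: q_def)
  show "q n ^ k / real k \<ge> 0" for n k
    using q by simp
  show "(\<lambda>k. q n ^ k / real k) sums - ln (1 - q n)" for n
    using sums_minus[OF ln_series'[of "- q n"]] q[of n] by simp
  have "(\<lambda>n. \<Prod>k=1..n. 1 - x\<^sup>2 / (real k)\<^sup>2) \<longlonglongrightarrow> sin (pi * x) / (pi * x)"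
    using sin_product_formula_real'[of x] x by simp
  moreover have "(\<Prod>k=1..n. 1 - x\<^sup>2 / (real k)\<^sup>2) = (\<Prod>k<n. 1 - q k)" for n
    unfolding q_def by (rule prod.reindex_bij_witness[of _ Suc "\<lambda>k. k - 1"]) auto
  ultimately have "(\<lambda>n. \<Prod>k<n. 1 - q k) \<longlonglongrightarrow> sin (pi * x) / (pi * x)"
    by simp
  then have "(\<lambda>n. - ln (\<Prod>k<n. 1 - q k)) \<longlonglongrightarrow> - ln (sin (pi * x) / (pi * x))"
    using sin_pi_pos[OF x] x by (intro tendsto_intros) auto
  moreover have "- ln (\<Prod>k<n. 1 - q k) = (\<Sum>k<n. - ln (1 - q k))" for n
    using q by (subst ln_prod) (auto simp: sum_negf less_imp_neq)
  ultimately show "(\<lambda>n. - ln (1 - q n)) sums - ln (sin (pi * x) / (pi * x))"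
    by (simp add: sums_def)
  show "(\<lambda>n. q n ^ k / real k) sums (zeta (2 * real k) / real k * (x\<^sup>2) ^ k)" for k
  proof (cases "k = 0")
    case False
    then show ?thesis
      using sums_mult2[OF zeta_even_sums[of k], of "(x\<^sup>2) ^ k / real k"]
      by (simp add: q_def power_divide mult_ac flip: power_mult)
  qed simp
qed

lemma sin_pi_sums: "(\<lambda>n. (-1) ^ n * pi ^ (2 * n) / fact (2 * n + 1) * (x\<^sup>2) ^ n) sums (sin (pi * x) / (pi * x))"
  if "x \<noteq> 0" for x :: real
proof -
  have "(-1) ^ n / fact (2 * n + 1) * (pi * x) ^ (2 * n + 1) / (pi * x) =
    (-1) ^ n * pi ^ (2 * n) / fact (2 * n + 1) * (x\<^sup>2) ^ n" for n
    using that by (simp add: power_mult_distrib power_mult[of x] del: fact_Suc)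
  then show ?thesis
    using sums_divide[OF sin_paired[of "pi * x"], of "pi * x"] by (simp only:)
qed

lemma cos_pi_sums: "(\<lambda>n. (-1) ^ n * pi ^ (2 * n) / fact (2 * n) * (x\<^sup>2) ^ n) sums cos (pi * x)"
  for x :: real
proof -
  have "(-1) ^ n / fact (2 * n) * (pi * x) ^ (2 * n) =
    (-1) ^ n * pi ^ (2 * n) / fact (2 * n) * (x\<^sup>2) ^ n" for n
    by (simp add: power_mult_distrib power_mult[of x])
  then show ?thesis
    using cos_paired[of "pi * x"] by (simp only:)
qed

text \<open>Obtained by differentiating \<open>ln_sin_sums\<close> termwise.\<close>
lemma cot_sums:
  fixes x :: real
  assumes x: "0 < x" "x < 1"
  shows "(\<lambda>k. (if k = 0 then 1 else - 2 * zeta (2 * real k)) * (x\<^sup>2) ^ k) sums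
           (pi * x * cos (pi * x) / sin (pi * x))"
    and "summable (\<lambda>k. norm ((if k = 0 then 1 else - 2 * zeta (2 * real k)) * (x\<^sup>2) ^ k))"
proof -
  define g where "g k = zeta (2 * real k) / real k" for k
  \<comment> \<open>Termwise differentiation at \<open>x^2\<close> requires convergence at a point
    of larger modulus; \<open>K^2\<close> serves, with \<open>K\<close> the midpoint of
    \<open>x\<close> and 1.\<close>
  define K where "K = (x + 1) / 2"
  have K: "x < K" "0 < K" "K < 1" using x by (auto simp: K_def)
  have summable_g: "summable (\<lambda>k. g k * (K\<^sup>2) ^ k)"
    using ln_sin_sums[of K] K unfolding g_def sums_iff by blast
  have xK: "norm (x\<^sup>2) < norm (K\<^sup>2)" using K x by (simp add: power_strict_mono)
  \<comment> \<open>The factor \<open>Suc k\<close> produced by differentiation cancels the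
    denominator of \<open>g (Suc k)\<close>.\<close>
  have diffs: "diffs g k = zeta (2 * real (Suc k))" for k
    by (simp add: diffs_def g_def del: of_nat_Suc)
  define D where "D = (\<Sum>k. diffs g k * (x\<^sup>2) ^ k)"
  have "((\<lambda>t. \<Sum>k. g k * t ^ k) has_field_derivative D) (at (x\<^sup>2))"
    unfolding D_def by (rule termdiffs_strong[OF summable_g xK])
  then have "((\<lambda>y. \<Sum>k. g k * (y\<^sup>2) ^ k) has_field_derivative D * (2 * x)) (at x)"
    by (rule DERIV_chain2) (auto intro!: derivative_eq_intros)
  \<comment> \<open>Both functions agree on a whole neighbourhood of \<open>x\<close>, so they share
    their derivative there; computing it directly then identifies \<open>D\<close>.\<close>
  moreover have ev: "\<forall>\<^sub>F y in nhds x. (\<Sum>k. g k * (y\<^sup>2) ^ k) = - ln (sin (pi * y) / (pi * y))"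
    using eventually_nhds_in_open[of "{0<..<1}" x] x
    by (auto elim!: eventually_mono simp: g_def dest!: ln_sin_sums simp: sums_iff)
  ultimately have "((\<lambda>y. - ln (sin (pi * y) / (pi * y))) has_field_derivative D * (2 * x)) (at x)"
    by (simp add: DERIV_cong_ev[OF refl ev refl])
  moreover have "((\<lambda>y. - ln (sin (pi * y) / (pi * y))) has_field_derivative
      (1 / x - pi * cos (pi * x) / sin (pi * x))) (at x)"
    using sin_pi_pos[OF x] x
    by (auto intro!: derivative_eq_intros simp: field_simps power2_eq_square)
  ultimately have "D * (2 * x) = 1 / x - pi * cos (pi * x) / sin (pi * x)"
    by (rule DERIV_unique)
  then have D: "1 - 2 * x\<^sup>2 * D = pi * x * cos (pi * x) / sin (pi * x)"
    using x sin_pi_pos[OF x] by (simp add: field_simps power2_eq_square)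
  have summable_D: "summable (\<lambda>k. diffs g k * (x\<^sup>2) ^ k)"
    by (rule termdiff_converges[where K = "K\<^sup>2"])
       (use xK in \<open>auto intro: powser_inside[OF summable_g]\<close>)
  define z where "z k = (if k = 0 then 1 else - 2 * zeta (2 * real k))" for k
  have Suc: "z (Suc k) * (x\<^sup>2) ^ Suc k = (- 2 * x\<^sup>2) * (diffs g k * (x\<^sup>2) ^ k)" for k
    by (simp add: z_def diffs)
  have "(\<lambda>k. z (Suc k) * (x\<^sup>2) ^ Suc k) sums (- 2 * x\<^sup>2 * D)"
    unfolding Suc D_def by (intro sums_mult summable_sums summable_D)
  then show "(\<lambda>k. z k * (x\<^sup>2) ^ k) sums (pi * x * cos (pi * x) / sin (pi * x))"
    unfolding D[symmetric] by (subst (asm) sums_Suc_iff) (simp add: z_def algebra_simps)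
  \<comment> \<open>Even zeta values are nonnegative, so all these terms have the same sign and
    convergence is already absolute, as the Cauchy product will require.\<close>
  have "norm (z (Suc k) * (x\<^sup>2) ^ Suc k) = (2 * x\<^sup>2) * (diffs g k * (x\<^sup>2) ^ k)" for k
    unfolding Suc using zeta_even_nonneg[of "Suc k"] by (simp add: diffs abs_mult)
  then have "summable (\<lambda>k. norm (z (Suc k) * (x\<^sup>2) ^ Suc k))"
    by (simp only: summable_mult[OF summable_D])
  then show "summable (\<lambda>k. norm (z k * (x\<^sup>2) ^ k))"
    by (subst (asm) summable_Suc_iff)
qed

section \<open>Comparison of coefficients and the recurrence\<close>

text \<open>With \<open>t = x^2\<close>, both sides are the coefficient of \<open>t ^ p\<close> in
  the identity (pi x cot(pi x)) * (sin(pi x) / (pi x)) = cos(pi x).\<close>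

lemma zeta_even_convolution:
  "(\<Sum>k\<le>p. (if k = 0 then 1 else - 2 * zeta (2 * real k)) *
      ((-1) ^ (p - k) * pi ^ (2 * (p - k)) / fact (2 * (p - k) + 1)))
    = (-1) ^ p * pi ^ (2 * p) / fact (2 * p)"
proof -
  define z where "z k = (if k = 0 then 1 else - 2 * zeta (2 * real k))" for k
  define s where "s n = (-1) ^ n * pi ^ (2 * n) / fact (2 * n + 1)" for n
  define c where "c n = (-1) ^ n * pi ^ (2 * n) / fact (2 * n)" for n
  have "(\<lambda>p. ((\<Sum>k\<le>p. z k * s (p - k)) - c p) * t ^ p) sums 0" if t: "0 < t" "t < 1" for t
  proof -
    define x where "x = sqrt t"
    have x: "0 < x" "x < 1" "t = x\<^sup>2" using t by (auto simp: x_def)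
    have sin: "(\<lambda>n. s n * t ^ n) sums (sin (pi * x) / (pi * x))"
      unfolding s_def x(3) by (rule sin_pi_sums) (use x in simp)
    \<comment> \<open>Convergence at the point 1 forces absolute convergence for
      \<open>t < 1\<close>.\<close>
    have "summable (\<lambda>n. s n * 1 ^ n)"
      using sin_pi_sums[of 1] unfolding s_def by (simp add: sums_iff)
    then have "summable (\<lambda>n. norm (s n * t ^ n))"
      by (rule powser_insidea) (use t in simp)
    then have "(\<lambda>p. \<Sum>k\<le>p. (z k * t ^ k) * (s (p - k) * t ^ (p - k))) sums
        ((\<Sum>k. z k * t ^ k) * (\<Sum>n. s n * t ^ n))"
      using cot_sums(2)[OF x(1,2)] by (intro Cauchy_product_sums) (simp_all add: z_def x(3))
    moreover have "(\<Sum>k. z k * t ^ k) * (\<Sum>n. s n * t ^ n) = cos (pi * x)"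
      using cot_sums(1)[OF x(1,2)] sin sin_pi_pos[OF x(1,2)] x
      by (simp add: sums_iff z_def)
    moreover have "(\<Sum>k\<le>p. (z k * t ^ k) * (s (p - k) * t ^ (p - k))) =
        (\<Sum>k\<le>p. z k * s (p - k)) * t ^ p" for p
      unfolding sum_distrib_right
      by (intro sum.cong) (auto simp flip: power_add)
    ultimately have "(\<lambda>p. (\<Sum>k\<le>p. z k * s (p - k)) * t ^ p) sums cos (pi * x)"
      by simp
    from sums_diff[OF this cos_pi_sums[of x]] show ?thesis
      by (simp add: c_def x(3) left_diff_distrib)
  qed
  from powser_sums_0_imp_coeff_0[of 1, OF _ this] show ?thesis
    by (simp add: z_def s_def c_def)
qed

text \<open>Dividing the convolution identity by \<open>(-1) ^ p * pi ^ (2 * p)\<close> removes the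
  powers of \<open>pi\<close>; the term \<open>k = p\<close> is then isolated. The case
  \<open>p = 1\<close> is included: its sum is empty.\<close>

lemma zeta_even_recurrence:
  assumes b: "\<And>k. b k = zeta (2 * real k) / pi ^ (2 * k)" and "p \<ge> 1"
  shows "b p = (-1) ^ (p - 1) / fact (2 * p) *
        (real p / real (2 * p + 1)
         - (\<Sum>k = 1..p - 1. (-1) ^ (k - 1) * (fact (2 * p) / fact (2 * p + 1 - 2 * k)) * b k))"
proof -
  define S where "S = (\<Sum>k = 1..p - 1. (-1) ^ (k - 1) * b k / fact (2 * p + 1 - 2 * k))"
  have split: "{..p} = insert 0 {1..p}" "{1..p} = insert p {1..p - 1}"
    using \<open>p \<ge> 1\<close> by auto
  define w where "w = (-1) ^ p * pi ^ (2 * p)"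
  have summand: "(if k = 0 then 1 else - 2 * zeta (2 * real k)) *
      ((-1) ^ (p - k) * pi ^ (2 * (p - k)) / fact (2 * (p - k) + 1))
      = w * (2 * ((-1) ^ (k - 1) * b k / fact (2 * p + 1 - 2 * k)))"
    if "k \<in> {1..p}" for k
  proof -
    have "2 * p + 1 - 2 * k = 2 * (p - k) + 1" using that by auto
    moreover have "pi ^ (2 * p) = pi ^ (2 * (p - k)) * pi ^ (2 * k)"
      unfolding power_add[symmetric] using that by (intro arg_cong[of _ _ "power pi"]) auto
    \<comment> \<open>The minus sign split off here turns the coefficient -2 of the zeta values into
      2.\<close>
    moreover have "(-1::real) ^ (p - k) = - ((-1) ^ p * (-1) ^ (k - 1))"
      using that by (auto simp: minus_one_power_iff)
    ultimately show ?thesis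
      using that by (simp add: w_def b del: fact_Suc)
  qed
  let ?F = "\<lambda>k. (if k = 0 then 1 else - 2 * zeta (2 * real k)) *
      ((-1) ^ (p - k) * pi ^ (2 * (p - k)) / fact (2 * (p - k) + 1))"
  have "w * (1 / fact (2 * p)) = sum ?F {..p}"
    using zeta_even_convolution[of p] by (simp add: w_def)
  also have "\<dots> = ?F 0 + sum ?F {1..p}"
    unfolding split(1) by (subst sum.insert) auto
  also have "sum ?F {1..p} =
      (\<Sum>k = 1..p. w * (2 * ((-1) ^ (k - 1) * b k / fact (2 * p + 1 - 2 * k))))"
    by (rule sum.cong[OF refl summand])
  also have "?F 0 = w * (1 / fact (2 * p + 1))"
    by (simp add: w_def)
  finally have "w * (1 / fact (2 * p + 1) +
      2 * (\<Sum>k = 1..p. (-1) ^ (k - 1) * b k / fact (2 * p + 1 - 2 * k))) = w * (1 / fact (2 * p))"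
    by (simp only: sum_distrib_left distrib_left)
  moreover have "w \<noteq> 0" by (simp add: w_def)
  moreover have "(\<Sum>k = 1..p. (-1) ^ (k - 1) * b k / fact (2 * p + 1 - 2 * k)) = (-1) ^ (p - 1) * b p + S"
    using \<open>p \<ge> 1\<close> by (subst split(2), subst sum.insert) (auto simp: S_def)
  ultimately have "1 / fact (2 * p + 1) + 2 * ((-1) ^ (p - 1) * b p + S) = 1 / fact (2 * p)"
    by (simp only: mult_cancel_left simp_thms)
  moreover have "1 / fact (2 * p) - 1 / fact (2 * p + 1) = 2 * (real p / real (2 * p + 1) / fact (2 * p))"
    by (simp add: divide_simps)
  \<comment> \<open>Solves the linear relation for its unknown, to be used with
    \<open>u = (-1) ^ (p - 1) * b p\<close>.\<close>
  moreover have "u = v - S" if "x + 2 * (u + S) = y" "y - x = 2 * v" for u v x y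
    using that by (simp add: algebra_simps)
  ultimately have eq: "(-1) ^ (p - 1) * b p = real p / real (2 * p + 1) / fact (2 * p) - S"
    by blast
  have "b p = (-1) ^ (p - 1) * ((-1) ^ (p - 1) * b p)"
    by (simp flip: power_add mult.assoc)
  also have "\<dots> = (-1) ^ (p - 1) / fact (2 * p) * (real p / real (2 * p + 1) - fact (2 * p) * S)"
    unfolding eq by (simp add: right_diff_distrib)
  also have "fact (2 * p) * S =
      (\<Sum>k = 1..p - 1. (-1) ^ (k - 1) * (fact (2 * p) / fact (2 * p + 1 - 2 * k)) * b k)"
    unfolding S_def sum_distrib_left by (intro sum.cong) (simp_all add: mult_ac)
  finally show ?thesis .
qed

section \<open>The alternating series\<close>

text \<open>Passing from \<open>zeta s\<close> to \<open>xi s\<close> subtracts the terms of the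
  even integers twice, and these terms sum to \<open>2 powr (- s) * zeta s\<close>.\<close>

lemma xi_eq_zeta:
  assumes "s > 1"
  shows "xi s = (1 - 2 powr (1 - s)) * zeta s"
proof -
  define f where "f n = 1 / real (Suc n) powr s" for n
  have f: "f sums zeta s"
    unfolding f_def zeta_def by (intro summable_sums summable_zeta assms)
  \<comment> \<open>Index \<open>n\<close> stands for the integer \<open>n + 1\<close>, so the even
    integers sit at the odd indices.\<close>
  have f_odd: "f (2 * m + 1) = 2 powr (- s) * f m" for m
  proof -
    have "real (Suc (2 * m + 1)) = 2 * real (Suc m)" by simp
    then show ?thesis
      by (simp only: f_def powr_mult) (simp add: powr_minus field_simps)
  qed
  have "(\<lambda>m. 2 * f (2 * m + 1)) sums (2 * (2 powr (- s) * zeta s))"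
    unfolding f_odd by (intro sums_mult f)
  \<comment> \<open>The weight \<open>1 - (-1) ^ n\<close> is 2 at odd and 0 at even indices, so the
    series over odd indices reindexes to one over all of them.\<close>
  moreover have "(1 - (-1) ^ n) * f n = 0" if "n \<notin> range (\<lambda>m. 2 * m + 1)" for n
    using that by (cases "even n") (auto elim!: oddE)
  ultimately have "(\<lambda>n. (1 - (-1) ^ n) * f n) sums (2 * (2 powr (- s) * zeta s))"
    using sums_mono_reindex[of "\<lambda>m. 2 * m + 1" "\<lambda>n. (1 - (-1) ^ n) * f n"]
    by (simp add: strict_mono_def)
  from sums_diff[OF f this]
  have "(\<lambda>n. (-1) ^ n * f n) sums (zeta s - 2 * (2 powr (- s) * zeta s))"
    by (simp add: algebra_simps)
  then show ?thesis
    by (simp add: f_def xi_def sums_iff powr_diff powr_minus field_simps)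
qed

section \<open>Rational coefficients and uniqueness\<close>

text \<open>Taking the recurrence as a recursive definition with values in \<open>rat\<close> builds
  rationality into the type. At \<open>p = 1\<close> the sum is empty and the value is (1/2) * (1/3)
  = 1/6.\<close>

fun zeta_coeff :: "nat \<Rightarrow> rat" where
  "zeta_coeff p = (-1) ^ (p - 1) / fact (2 * p) *
     (of_nat p / of_nat (2 * p + 1)
      - (\<Sum>k = 1..p - 1. (-1) ^ (k - 1) * (fact (2 * p) / fact (2 * p + 1 - 2 * k)) * zeta_coeff k))"

declare zeta_coeff.simps [simp del]

lemma of_rat_fact: "(of_rat (fact n) :: 'a :: field_char_0) = fact n"
  by (metis of_nat_fact of_rat_of_nat_eq)

text \<open>By strong induction, since both sides obey the same recurrence, one over the rationals
  and one over the reals.\<close>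

lemma zeta_even_eq: "p \<ge> 1 \<Longrightarrow> of_rat (zeta_coeff p) = zeta (2 * real p) / pi ^ (2 * p)"
proof (induction p rule: less_induct)
  case (less p)
  then show ?case
    by (subst zeta_even_recurrence[OF refl], simp, subst zeta_coeff.simps,
        simp add: of_rat_mult of_rat_divide of_rat_diff of_rat_add of_rat_sum of_rat_power of_rat_minus
          of_rat_fact del: fact_Suc, intro sum.cong, use less.IH in auto)
qed

lemma zeta_recurrence_zeta_coeff: "zeta_recurrence zeta_coeff"
  unfolding zeta_recurrence_def
proof (intro conjI allI impI)
  show "zeta_coeff 1 = 1 / 6"
    by (subst zeta_coeff.simps) (simp add: fact_numeral)
qed (rule zeta_coeff.simps)

text \<open>For \<open>p \<ge> 2\<close> the right-hand side involves only the values at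
  \<open>1, ..., p - 1\<close>. The value at 0 is unconstrained, hence agreement from 1 on.\<close>

lemma zeta_recurrence_unique:
  assumes "zeta_recurrence B" "zeta_recurrence C" "p \<ge> 1"
  shows "B p = C p"
  using \<open>p \<ge> 1\<close>
proof (induction p rule: less_induct)
  case (less p)
  show ?case
  proof (cases "p = 1")
    case False
    then have "p \<ge> 2" using less by simp
    define rhs :: "(nat \<Rightarrow> rat) \<Rightarrow> rat" where
      "rhs D = (-1) ^ (p - 1) / fact (2 * p) *
        (of_nat p / of_nat (2 * p + 1)
         - (\<Sum>k = 1..p - 1. (-1) ^ (k - 1) * (fact (2 * p) / fact (2 * p + 1 - 2 * k)) * D k))" for D
    have "B p = rhs B" "C p = rhs C"
      using assms(1,2) \<open>p \<ge> 2\<close> unfolding zeta_recurrence_def rhs_def by blast+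
    moreover have "rhs B = rhs C"
      unfolding rhs_def using less.IH
      by (intro arg_cong2[of _ _ _ _ "(*)"] arg_cong2[of _ _ _ _ "(-)"] sum.cong refl) auto
    ultimately show ?thesis by simp
  qed (use assms in \<open>simp add: zeta_recurrence_def\<close>)
qed

theorem proposition4:
  "\<exists>B :: nat \<Rightarrow> rat.
     (\<forall>p\<ge>1. zeta (2 * real p) = of_rat (B p) * pi ^ (2 * p)) \<and>
     zeta_recurrence B \<and>
     (\<forall>C. zeta_recurrence C \<longrightarrow> (\<forall>p\<ge>1. C p = B p)) \<and>
     (\<forall>p\<ge>1. of_rat (B p) = 4 ^ p / (4 ^ p - 2) * A p)"
proof (intro exI[of _ zeta_coeff] conjI allI impI)
  fix p :: nat assume p: "p \<ge> 1"
  show "zeta (2 * real p) = of_rat (zeta_coeff p) * pi ^ (2 * p)"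
    using zeta_even_eq[OF p] by simp
  have "2 powr (2 * real p) = (4::real) ^ p"
    using powr_realpow[of 2 "2 * p"] by (simp add: power_mult)
  then have "xi (2 * real p) = (1 - 2 / 4 ^ p) * zeta (2 * real p)"
    using xi_eq_zeta[of "2 * real p"] p by (simp add: powr_diff)
  then have "A p = (4 ^ p - 2) / 4 ^ p * of_rat (zeta_coeff p)"
    by (simp add: zeta_even_eq[OF p] A_def diff_divide_distrib)
  \<comment> \<open>From \<open>p \<ge> 1\<close> follows \<open>4 ^ p \<ge> 4\<close>, so the
    factor \<open>4 ^ p - 2\<close> can be inverted.\<close>
  moreover have "(4::real) ^ p \<noteq> 2"
    using power_increasing[of 1 p "4::real"] p by simp
  ultimately show "of_rat (zeta_coeff p) = 4 ^ p / (4 ^ p - 2) * A p"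
    by simp
qed (rule zeta_recurrence_zeta_coeff, rule zeta_recurrence_unique[OF _ zeta_recurrence_zeta_coeff])

end
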